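(* Let $k\ge1$ be an integer. The following randomized online algorithm for \textsc{MBM}: assign to each $b\in B$ a category $c(b)\in\{1,\dots,2^k\}$ independently and uniformly at random, and return $\textsc{Ranking}(\sigma_c)$, uses $k\cdot m$ random bits and has competitive ratio $1-\left(\frac{2^k}{2^k+1}\right)^{2^k}$, i.e., on every input $\mathbb{E}|M|\ge\left(1-\left(\frac{2^k}{2^k+1}\right)^{2^k}\right)|M^*|$ where $M$ is its output and $M^*$ a maximum matching.
   Context: Online maximum bipartite matching (\textsc{MBM}): the input is a bipartite graph $G=(A,B,E)$ with $A=[n]$, $B=[m]$, $m=\Theta(n)$; the $A$-vertices, together with their incident edges, arrive one at a time in an adversarially chosen order, and upon arrival of $a\in A$ the algorithm must irrevocably match $a$ to a currently unmatched neighbour or leave it unmatched. Given a category function $c:B\to\{1,\dots,2^k\}$, $\sigma_c$ is the unique permutation of $B$ with $\sigma_c(b_1)<\sigma_c(b_2)$ iff $c(b_1)<c(b_2)$, or $c(b_1)=c(b_2)$ and $b_1<b_2$. $\textsc{Ranking}(\sigma)$ matches each arriving $A$-vertex to its unmatched neighbour $b$ of minimum rank $\sigma(b)$, leaving it unmatched if none exists. *)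

theory Defs
  imports "HOL-Probability.Probability" "HOL-Combinatorics.Permutations"
begin

text \<open>Bipartite graphs on \<open>A = {1..n}\<close> and \<open>B = {1..m}\<close> are given by their edge sets
  \<open>E \<subseteq> {1..n} \<times> {1..m}\<close>; the two sides are told apart by the position in the pair.\<close>

definition is_matching :: "(nat \<times> nat) set \<Rightarrow> (nat \<times> nat) set \<Rightarrow> bool" where
  "is_matching E M \<longleftrightarrow> M \<subseteq> E \<and> inj_on fst M \<and> inj_on snd M"

definition is_maximum_matching :: "(nat \<times> nat) set \<Rightarrow> (nat \<times> nat) set \<Rightarrow> bool" where
  "is_maximum_matching E M \<longleftrightarrow>
     is_matching E M \<and> (\<forall>M'. is_matching E M' \<longrightarrow> card M' \<le> card M)"

text \<open>A deterministic online rule decides on the partner of an arriving vertex from the earlier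
  arrivals (with their neighbourhoods), the current matching, the arriving vertex and its
  neighbourhood.\<close>

type_synonym online_rule =
  "(nat \<times> nat set) list \<Rightarrow> (nat \<times> nat) set \<Rightarrow> nat \<Rightarrow> nat set \<Rightarrow> nat option"

definition legal_rule :: "online_rule \<Rightarrow> bool" where
  "legal_rule r \<longleftrightarrow> (\<forall>h M a N b. r h M a N = Some b \<longrightarrow> b \<in> N \<and> b \<notin> snd ` M)"

fun run_from ::
  "online_rule \<Rightarrow> (nat \<times> nat) set \<Rightarrow> (nat \<times> nat set) list \<Rightarrow> (nat \<times> nat) set \<Rightarrow> nat list
     \<Rightarrow> (nat \<times> nat) set" where
  "run_from r E h M [] = M"
| "run_from r E h M (a # as) =
     run_from r E (h @ [(a, E `` {a})])
       (case r h M a (E `` {a}) of None \<Rightarrow> M | Some b \<Rightarrow> insert (a, b) M) as"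

definition online_matching ::
  "online_rule \<Rightarrow> (nat \<times> nat) set \<Rightarrow> nat list \<Rightarrow> (nat \<times> nat) set" where
  "online_matching r E arrivals = run_from r E [] {} arrivals"

text \<open>Randomized computations whose only source of randomness is a sequence of fair coin flips.\<close>

datatype 'a coin = Return 'a | Flip "bool \<Rightarrow> 'a coin"

primrec bind_coin :: "'a coin \<Rightarrow> ('a \<Rightarrow> 'b coin) \<Rightarrow> 'b coin" where
  "bind_coin (Return x) g = g x"
| "bind_coin (Flip f) g = Flip (\<lambda>u. bind_coin (f u) g)"

primrec coin_pmf :: "'a coin \<Rightarrow> 'a pmf" where
  "coin_pmf (Return x) = return_pmf x"
| "coin_pmf (Flip f) = bind_pmf (bernoulli_pmf (1 / 2)) (\<lambda>u. coin_pmf (f u))"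

inductive uses_random_bits :: "'a coin \<Rightarrow> nat \<Rightarrow> bool" where
  "uses_random_bits (Return x) 0"
| "(\<And>u. uses_random_bits (f u) r) \<Longrightarrow> uses_random_bits (Flip f) (Suc r)"

text \<open>A randomized online algorithm knows \<open>B = {1..m}\<close> in advance: its argument is \<open>m\<close>, and it
  draws its random bits before the first arrival.\<close>

type_synonym randomized_online_algorithm = "nat \<Rightarrow> online_rule coin"

definition legal_algorithm :: "randomized_online_algorithm \<Rightarrow> bool" where
  "legal_algorithm alg \<longleftrightarrow> (\<forall>m. \<forall>r \<in> set_pmf (coin_pmf (alg m)). legal_rule r)"

definition has_competitive_ratio :: "randomized_online_algorithm \<Rightarrow> real \<Rightarrow> bool" where
  "has_competitive_ratio alg \<rho> \<longleftrightarrow>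
     (\<forall>n m E arrivals Mstar.
        E \<subseteq> {1..n} \<times> {1..m} \<longrightarrow>
        distinct arrivals \<longrightarrow> set arrivals = {1..n} \<longrightarrow>
        is_maximum_matching E Mstar \<longrightarrow>
        measure_pmf.expectation (coin_pmf (alg m)) (\<lambda>r. real (card (online_matching r E arrivals)))
          \<ge> \<rho> * real (card Mstar))"

definition ranking :: "(nat \<Rightarrow> nat) \<Rightarrow> online_rule" where
  "ranking \<sigma> h M a N =
     (if N - snd ` M = {} then None else Some (arg_min_on \<sigma> (N - snd ` M)))"

definition is_category_perm :: "nat \<Rightarrow> (nat \<Rightarrow> nat) \<Rightarrow> (nat \<Rightarrow> nat) \<Rightarrow> bool" where
  "is_category_perm m c \<sigma> \<longleftrightarrow>
     \<sigma> permutes {1..m} \<and>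
     (\<forall>b1 \<in> {1..m}. \<forall>b2 \<in> {1..m}.
        \<sigma> b1 < \<sigma> b2 \<longleftrightarrow> c b1 < c b2 \<or> (c b1 = c b2 \<and> b1 < b2))"

definition category_perm :: "nat \<Rightarrow> (nat \<Rightarrow> nat) \<Rightarrow> nat \<Rightarrow> nat" where
  "category_perm m c = (THE \<sigma>. is_category_perm m c \<sigma>)"

lemma is_category_perm_ex1: "\<exists>!\<sigma>. is_category_perm m c \<sigma>"
proof -
  define B where "B = {1..m}"
  define lt where "lt x y \<longleftrightarrow> c x < c y \<or> (c x = c y \<and> x < y)" for x y :: nat
  define \<tau> where "\<tau> b = (if b \<in> B then card {x \<in> B. \<not> lt b x} else b)" for b
  have fin: "finite B" by (simp add: B_def)
  have mono: "\<tau> x < \<tau> y" if "x \<in> B" "y \<in> B" "lt x y" for x y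
  proof -
    have "{z \<in> B. \<not> lt x z} \<subseteq> {z \<in> B. \<not> lt y z}" "y \<in> {z \<in> B. \<not> lt y z}"
      "y \<notin> {z \<in> B. \<not> lt x z}"
      using that by (auto simp: lt_def)
    then have "{z \<in> B. \<not> lt x z} \<subset> {z \<in> B. \<not> lt y z}" by blast
    then show ?thesis using that fin by (simp add: \<tau>_def psubset_card_mono)
  qed
  have total: "lt x y \<or> x = y \<or> lt y x" for x y by (auto simp: lt_def)
  have iff: "\<tau> x < \<tau> y \<longleftrightarrow> lt x y" if "x \<in> B" "y \<in> B" for x y
    using mono[of x y] mono[of y x] total[of x y] that by (metis less_asym less_irrefl)
  have inj: "inj_on \<tau> B"
    by (rule inj_onI) (use mono total in \<open>metis less_irrefl\<close>)
  have sub: "\<tau> ` B \<subseteq> B"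
  proof
    fix y assume "y \<in> \<tau> ` B"
    then obtain b where b: "b \<in> B" "y = card {x \<in> B. \<not> lt b x}" by (auto simp: \<tau>_def)
    have "b \<in> {x \<in> B. \<not> lt b x}" using b by (simp add: lt_def)
    then have "y > 0" unfolding b(2) card_gt_0_iff using fin by auto
    moreover have "y \<le> card B" using b fin by (auto intro: card_mono)
    ultimately show "y \<in> B" by (simp add: B_def)
  qed
  have "bij_betw \<tau> B B" using endo_inj_surj[OF fin sub inj] inj by (simp add: bij_betw_def)
  then have "\<tau> permutes B" by (rule bij_imp_permutes) (simp add: \<tau>_def)
  then have ex: "is_category_perm m c \<tau>"
    using iff by (simp add: is_category_perm_def B_def lt_def)
  have "\<sigma> b = \<tau> b" if \<sigma>: "is_category_perm m c \<sigma>" for \<sigma> b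
  proof (cases "b \<in> B")
    case True
    have p: "\<sigma> permutes B" and i: "\<And>x y. x \<in> B \<Longrightarrow> y \<in> B \<Longrightarrow> \<sigma> x < \<sigma> y \<longleftrightarrow> lt x y"
      using \<sigma> by (simp_all add: is_category_perm_def B_def lt_def)
    have sb: "\<sigma> b \<in> B" using permutes_in_image[OF p] True by simp
    have "\<sigma> ` {x \<in> B. \<not> lt b x} = {1..\<sigma> b}"
    proof
      show "\<sigma> ` {x \<in> B. \<not> lt b x} \<subseteq> {1..\<sigma> b}"
        using i[OF True] permutes_in_image[OF p] by (fastforce simp: B_def)
      show "{1..\<sigma> b} \<subseteq> \<sigma> ` {x \<in> B. \<not> lt b x}"
      proof
        fix y assume y: "y \<in> {1..\<sigma> b}"
        then have "y \<in> B" using sb by (simp add: B_def)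
        then obtain x where "x \<in> B" "y = \<sigma> x" using permutes_image[OF p] by blast
        then show "y \<in> \<sigma> ` {x \<in> B. \<not> lt b x}" using y i[OF True] by force
      qed
    qed
    moreover have "inj_on \<sigma> {x \<in> B. \<not> lt b x}" using permutes_inj_on[OF p] .
    ultimately have "card {1..\<sigma> b} = card {x \<in> B. \<not> lt b x}" using card_image by metis
    then show ?thesis using True by (simp add: \<tau>_def)
  next
    case False
    have "\<sigma> permutes B" using \<sigma> by (simp add: is_category_perm_def B_def)
    then show ?thesis using False permutes_not_in[of \<sigma> B b] by (simp add: \<tau>_def)
  qed
  then have "\<sigma> = \<tau>" if "is_category_perm m c \<sigma>" for \<sigma> using that by blast
  with ex show ?thesis by blast
qed

text \<open>A category in \<open>{1..2 ^ k}\<close> is drawn by reading \<open>k\<close> bits as a binary number and adding 1.\<close>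

primrec draw_bits :: "nat \<Rightarrow> bool list coin" where
  "draw_bits 0 = Return []"
| "draw_bits (Suc k) = Flip (\<lambda>u. map_coin (\<lambda>us. u # us) (draw_bits k))"

definition draw_category :: "nat \<Rightarrow> nat coin" where
  "draw_category k = map_coin (\<lambda>us. 1 + horner_sum of_bool 2 us) (draw_bits k)"

primrec draw_categories :: "nat \<Rightarrow> nat list \<Rightarrow> (nat \<Rightarrow> nat) coin" where
  "draw_categories k [] = Return (\<lambda>_. 0)"
| "draw_categories k (b # bs) =
     bind_coin (draw_category k) (\<lambda>x. map_coin (\<lambda>c. c(b := x)) (draw_categories k bs))"

definition random_categories :: "nat \<Rightarrow> nat \<Rightarrow> (nat \<Rightarrow> nat) coin" where
  "random_categories k m = draw_categories k [1..<Suc m]"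

definition category_ranking :: "nat \<Rightarrow> randomized_online_algorithm" where
  "category_ranking k m = map_coin (\<lambda>c. ranking (category_perm m c)) (random_categories k m)"

end

theory Submission
  imports Defs
begin

text \<open>
  Write \<open>K = 2 ^ k\<close> and split the unit gained by matching \<open>a\<close> to a vertex of category \<open>t\<close> into
  \<open>g t\<close> for the \<open>B\<close>-vertex and \<open>1 - g t\<close> for \<open>a\<close>, where
  \<open>g t = (K / (K + 1)) ^ (K + 1 - t)\<close> (\<open>share K t\<close> below). It suffices that every edge
  \<open>(a, b)\<close> receives \<open>1 - g 1\<close> in expectation from its two endpoints.
  Fix the categories of all vertices other than \<open>b\<close>, and let \<open>y\<close> be the category of the partner of \<open>a\<close> in
  the run on the graph without \<open>b\<close> (\<open>K + 1\<close> if \<open>a\<close> stays unmatched). Putting \<open>b\<close> back never worsens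
  the partner of \<open>a\<close>, so \<open>a\<close> keeps at least \<open>1 - g y\<close>; and \<open>b\<close> is matched whenever its category
  is below \<open>y\<close>. The function \<open>g\<close> solves \<open>1 - g y + (g 1 + \<dots> + g (y - 1)) / K = 1 - g 1\<close> for all
  \<open>y \<le> K + 1\<close> with \<open>g (K + 1) = 1\<close>.
\<close>

section \<open>Coin-flip computations\<close>

lemma coin_pmf_map_coin: "coin_pmf (map_coin f x) = map_pmf f (coin_pmf x)"
  by (induction x) (simp_all add: map_bind_pmf)

lemma coin_pmf_bind_coin: "coin_pmf (bind_coin x g) = bind_pmf (coin_pmf x) (\<lambda>v. coin_pmf (g v))"
  by (induction x) (simp_all add: bind_return_pmf bind_assoc_pmf)

section \<open>Number of coin flips\<close>

lemma uses_random_bits_map_coin: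
  "uses_random_bits x r \<Longrightarrow> uses_random_bits (map_coin f x) r"
  by (induction rule: uses_random_bits.induct) (auto intro: uses_random_bits.intros)

lemma uses_random_bits_bind_coin:
  "uses_random_bits x r \<Longrightarrow> (\<And>v. uses_random_bits (g v) s) \<Longrightarrow>
    uses_random_bits (bind_coin x g) (r + s)"
  by (induction rule: uses_random_bits.induct) (auto intro: uses_random_bits.intros)

lemma uses_random_bits_draw_bits: "uses_random_bits (draw_bits k) k"
  by (induction k) (auto intro: uses_random_bits.intros uses_random_bits_map_coin)

lemma uses_random_bits_draw_category: "uses_random_bits (draw_category k) k"
  unfolding draw_category_def by (intro uses_random_bits_map_coin uses_random_bits_draw_bits)

lemma uses_random_bits_draw_categories:
  "uses_random_bits (draw_categories k bs) (k * length bs)"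
  by (induction bs)
    (auto intro!: uses_random_bits.intros uses_random_bits_bind_coin
      uses_random_bits_map_coin uses_random_bits_draw_category)

lemma uses_random_bits_category_ranking: "uses_random_bits (category_ranking k m) (k * m)"
  using uses_random_bits_draw_categories[of k "[1..<Suc m]"]
  by (simp add: category_ranking_def random_categories_def uses_random_bits_map_coin del: upt_Suc)

section \<open>Uniform distribution of the drawn categories\<close>

lemma map_horner_sum_draw_bits:
  "map_pmf (horner_sum of_bool 2) (coin_pmf (draw_bits k)) = pmf_of_set {..<2 ^ k :: nat}"
proof (induction k)
  case 0
  have "{..<Suc 0} = {0}" by auto
  then show ?case by (simp add: pmf_of_set_singleton)
next
  case (Suc k)
  \<comment> \<open>The first bit drawn is the least significant one. By induction the remaining
    bits give a uniform \<open>x\<close> below \<open>2 ^ k\<close>, independent of the bit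
    \<open>u\<close>, and \<open>?f\<close> is a bijection from such pairs onto the numbers below
    \<open>2 ^ Suc k\<close>, with parity and halving as inverse.\<close>
  let ?f = "\<lambda>(u, x). of_bool u + 2 * x :: nat"
  have "map_pmf (horner_sum of_bool 2) (coin_pmf (draw_bits (Suc k))) =
      bind_pmf (bernoulli_pmf (1 / 2)) (\<lambda>u. map_pmf (\<lambda>x. of_bool u + 2 * x)
        (map_pmf (horner_sum of_bool 2) (coin_pmf (draw_bits k))))"
    by (simp add: map_bind_pmf coin_pmf_map_coin pmf.map_comp o_def)
  also have "\<dots> = map_pmf ?f (pair_pmf (bernoulli_pmf (1 / 2)) (pmf_of_set {..<2 ^ k}))"
    unfolding Suc by (simp add: pair_pmf_def map_bind_pmf map_pmf_def bind_assoc_pmf bind_return_pmf)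
  also have "pair_pmf (bernoulli_pmf (1 / 2)) (pmf_of_set {..<2 ^ k :: nat}) =
      pmf_of_set (UNIV \<times> {..<2 ^ k})"
    by (intro pmf_eqI) (auto simp: bernoulli_pmf_half_conv_pmf_of_set pmf_pair pmf_of_set
        lessThan_empty_iff indicator_def split: prod.splits)
  also have "map_pmf ?f \<dots> = pmf_of_set {..<2 ^ Suc k}"
  proof (rule map_pmf_of_set_bij_betw)
    show "bij_betw ?f (UNIV \<times> {..<2 ^ k}) {..<2 ^ Suc k}"
      by (rule bij_betwI[where g = "\<lambda>x. (odd x, x div 2)"]) (auto split: if_splits)
  qed (auto simp: lessThan_empty_iff)
  finally show ?case .
qed

lemma coin_pmf_draw_category: "coin_pmf (draw_category k) = pmf_of_set {1..2 ^ k}"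
proof -
  have "coin_pmf (draw_category k) =
      map_pmf (\<lambda>x. 1 + x) (map_pmf (horner_sum of_bool 2) (coin_pmf (draw_bits k)))"
    by (simp add: draw_category_def coin_pmf_map_coin pmf.map_comp o_def)
  also have "\<dots> = pmf_of_set {1..2 ^ k}"
    unfolding map_horner_sum_draw_bits
  proof (rule map_pmf_of_set_bij_betw)
    show "bij_betw (\<lambda>x. 1 + x) {..<2 ^ k :: nat} {1..2 ^ k}"
      by (rule bij_betwI[where g = "\<lambda>x. x - 1"]) auto
  qed (auto simp: lessThan_empty_iff)
  finally show ?thesis .
qed

text \<open>The recursion of \<open>draw_categories\<close> is that of
  \<open>Pi_pmf_insert'\<close>; distinctness ensures that no earlier draw is overwritten. The
  constant function returned for the empty list supplies the default value 0 outside
  \<open>set bs\<close>.\<close>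

lemma coin_pmf_draw_categories:
  "distinct bs \<Longrightarrow>
    coin_pmf (draw_categories k bs) = Pi_pmf (set bs) 0 (\<lambda>_. pmf_of_set {1..2 ^ k})"
proof (induction bs)
  case (Cons b bs)
  then show ?case
    by (simp add: coin_pmf_bind_coin coin_pmf_map_coin coin_pmf_draw_category Pi_pmf_insert'
        map_pmf_def)
qed simp

lemma coin_pmf_random_categories:
  "coin_pmf (random_categories k m) = Pi_pmf {1..m} 0 (\<lambda>_. pmf_of_set {1..2 ^ k})"
proof -
  have "set [1..<Suc m] = {1..m}" by auto
  then show ?thesis
    using coin_pmf_draw_categories[of "[1..<Suc m]" k] by (simp add: random_categories_def del: upt_Suc)
qed

lemma coin_pmf_category_ranking:
  "coin_pmf (category_ranking k m) =
    map_pmf (\<lambda>c. ranking (category_perm m c)) (Pi_pmf {1..m} 0 (\<lambda>_. pmf_of_set {1..2 ^ k}))"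
  by (simp add: category_ranking_def coin_pmf_map_coin coin_pmf_random_categories)


section \<open>Runs of Ranking\<close>

lemma arg_min_on_nat_in: "S \<noteq> {} \<Longrightarrow> arg_min_on (f :: 'a \<Rightarrow> nat) S \<in> S"
  unfolding arg_min_on_def using arg_min_natI[of "\<lambda>x. x \<in> S"] by blast

lemma arg_min_on_nat_le: "x \<in> S \<Longrightarrow> f (arg_min_on f S) \<le> (f x :: nat)"
  unfolding arg_min_on_def by (rule arg_min_nat_le)

text \<open>\<open>is_arg_min\<close> refers to its function only through strict comparisons, so
  both sides choose from the same predicate; they agree even if minimizers are not unique.\<close>

lemma arg_min_on_order_cong:
  assumes "\<And>x y. x \<in> S \<Longrightarrow> y \<in> S \<Longrightarrow> f x < f y \<longleftrightarrow> g x < g y"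
  shows "arg_min_on f S = arg_min_on g S"
proof -
  have "is_arg_min f (\<lambda>x. x \<in> S) = is_arg_min g (\<lambda>x. x \<in> S)"
    unfolding is_arg_min_def using assms by blast
  then show ?thesis by (simp add: arg_min_on_def arg_min_def)
qed

lemma legal_rule_ranking: "legal_rule (ranking \<sigma>)"
  unfolding legal_rule_def ranking_def using arg_min_on_nat_in
  by (metis DiffD1 DiffD2 option.distinct(1) option.sel)

definition rank_step ::
  "(nat \<Rightarrow> nat) \<Rightarrow> (nat \<times> nat) set \<Rightarrow> (nat \<times> nat) set \<Rightarrow> nat \<Rightarrow> (nat \<times> nat) set" where
  "rank_step \<sigma> E M a =
     (let F = E `` {a} - snd ` M in if F = {} then M else insert (a, arg_min_on \<sigma> F) M)"

text \<open>Ranking ignores the history, so the matching alone is the state of a run.\<close>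

lemma run_from_ranking: "run_from (ranking \<sigma>) E h M as = foldl (rank_step \<sigma> E) M as"
  by (induction as arbitrary: h M) (simp_all add: ranking_def rank_step_def Let_def)

lemma online_matching_ranking: "online_matching (ranking \<sigma>) E as = foldl (rank_step \<sigma> E) {} as"
  by (simp add: online_matching_def run_from_ranking)

lemma rank_step_mono: "M \<subseteq> rank_step \<sigma> E M a"
  by (auto simp: rank_step_def Let_def)

lemma foldl_rank_step_mono: "M \<subseteq> foldl (rank_step \<sigma> E) M as"
  by (induction as arbitrary: M) (use rank_step_mono in fastforce)+

lemma is_matching_rank_step:
  assumes "is_matching E M" "a \<notin> fst ` M"
  shows "is_matching E (rank_step \<sigma> E M a)"
proof (cases "E `` {a} - snd ` M = {}")
  case False
  then have "arg_min_on \<sigma> (E `` {a} - snd ` M) \<in> E `` {a} - snd ` M" by (rule arg_min_on_nat_in)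
  then show ?thesis using assms False
    by (auto simp: rank_step_def is_matching_def inj_on_def image_iff)
next
  case True
  then show ?thesis using assms(1) by (simp add: rank_step_def)
qed

lemma is_matching_foldl_rank_step:
  "is_matching E M \<Longrightarrow> distinct as \<Longrightarrow> fst ` M \<inter> set as = {} \<Longrightarrow>
    is_matching E (foldl (rank_step \<sigma> E) M as)"
proof (induction as arbitrary: M)
  case (Cons a as)
  have "fst ` rank_step \<sigma> E M a \<subseteq> insert a (fst ` M)" by (auto simp: rank_step_def Let_def)
  then have "fst ` rank_step \<sigma> E M a \<inter> set as = {}" using Cons.prems by auto
  then show ?case using Cons by (simp add: is_matching_rank_step)
qed simp

lemma is_matching_online_ranking:
  "distinct as \<Longrightarrow> is_matching E (online_matching (ranking \<sigma>) E as)"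
  unfolding online_matching_ranking
  by (rule is_matching_foldl_rank_step) (auto simp: is_matching_def)

text \<open>Every candidate set lies in \<open>S\<close>, and only the order on it matters. This
  makes the run without \<open>b\<close> independent of the category of \<open>b\<close>, although
  that category may shift the ranks of other vertices.\<close>

lemma online_ranking_order_cong:
  assumes "snd ` E \<subseteq> S" and "\<And>x y. x \<in> S \<Longrightarrow> y \<in> S \<Longrightarrow> \<sigma> x < \<sigma> y \<longleftrightarrow> \<tau> x < \<tau> y"
  shows "online_matching (ranking \<sigma>) E as = online_matching (ranking \<tau>) E as"
proof -
  have "arg_min_on \<sigma> (E `` {a} - snd ` M) = arg_min_on \<tau> (E `` {a} - snd ` M)"
    for M :: "(nat \<times> nat) set" and a
  proof (rule arg_min_on_order_cong)
    have "E `` {a} - snd ` M \<subseteq> S" using assms(1) by force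
    then show "\<sigma> x < \<sigma> y \<longleftrightarrow> \<tau> x < \<tau> y"
      if "x \<in> E `` {a} - snd ` M" "y \<in> E `` {a} - snd ` M" for x y
      using that by (intro assms(2)) blast+
  qed
  then have "rank_step \<sigma> E = rank_step \<tau> E" by (intro ext) (simp add: rank_step_def)
  then show ?thesis by (simp add: online_matching_ranking)
qed

section \<open>Effect of removing one vertex of \<open>B\<close> on a run\<close>

abbreviation delete_right :: "nat \<Rightarrow> (nat \<times> nat) set \<Rightarrow> (nat \<times> nat) set" where
  "delete_right b E \<equiv> {e \<in> E. snd e \<noteq> b}"

text \<open>Matchings only grow, so a \<open>b\<close> that is free at the end was never chosen.
  Removing it from the candidate sets therefore keeps every minimizer, which is unique because
  \<open>\<sigma>\<close> is injective.\<close>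

lemma foldl_rank_step_delete_right:
  assumes "inj \<sigma>" "b \<notin> snd ` foldl (rank_step \<sigma> E) M as"
  shows "foldl (rank_step \<sigma> (delete_right b E)) M as = foldl (rank_step \<sigma> E) M as"
  using assms(2)
proof (induction as arbitrary: M)
  case (Cons a as)
  let ?F = "E `` {a} - snd ` M" and ?F' = "delete_right b E `` {a} - snd ` M"
  have F': "?F' = ?F - {b}" by auto
  have nb: "b \<notin> snd ` rank_step \<sigma> E M a"
    using Cons.prems foldl_rank_step_mono[of "rank_step \<sigma> E M a" \<sigma> E as] by (simp add: image_iff) blast
  have "rank_step \<sigma> (delete_right b E) M a = rank_step \<sigma> E M a"
  proof (cases "?F = {}")
    case True
    then have "?F' = {}" using F' by blast
    with True show ?thesis by (simp only: rank_step_def Let_def if_True)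
  next
    case False
    let ?v = "arg_min_on \<sigma> ?F" and ?v' = "arg_min_on \<sigma> ?F'"
    have v: "?v \<in> ?F" using False by (rule arg_min_on_nat_in)
    moreover have "?v \<noteq> b" using nb False by (auto simp: rank_step_def)
    ultimately have vF': "?v \<in> ?F'" using F' by blast
    then have "?v' \<in> ?F'" by (intro arg_min_on_nat_in) blast
    then have "\<sigma> ?v \<le> \<sigma> ?v'" by (intro arg_min_on_nat_le) blast
    moreover have "\<sigma> ?v' \<le> \<sigma> ?v" using vF' by (rule arg_min_on_nat_le)
    ultimately have "?v' = ?v" using assms(1) by (simp add: inj_eq)
    then show ?thesis using False vF' unfolding rank_step_def Let_def by auto
  qed
  then show ?case using Cons by simp
qed simp

lemma online_ranking_delete_right:
  "inj \<sigma> \<Longrightarrow> b \<notin> snd ` online_matching (ranking \<sigma>) E as \<Longrightarrow>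
    online_matching (ranking \<sigma>) (delete_right b E) as = online_matching (ranking \<sigma>) E as"
  unfolding online_matching_ranking by (rule foldl_rank_step_delete_right)

text \<open>The invariant \<open>snd ` M \<subseteq> insert b (snd ` M')\<close> says that whatever is free in the run without
  \<open>b\<close> is also free in the run with \<open>b\<close>; hence \<open>a\<close> has at least as good a choice there.\<close>

lemma foldl_rank_step_dominates:
  assumes "inj \<sigma>" "snd ` M \<subseteq> insert b (snd ` M')"
    and "\<And>a u'. (a, u') \<in> M' \<Longrightarrow> \<exists>u. (a, u) \<in> M \<and> \<sigma> u \<le> \<sigma> u'"
    and "(a, u') \<in> foldl (rank_step \<sigma> (delete_right b E)) M' as"
  shows "\<exists>u. (a, u) \<in> foldl (rank_step \<sigma> E) M as \<and> \<sigma> u \<le> \<sigma> u'"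
  using assms(2-4)
proof (induction as arbitrary: M M')
  case (Cons x as)
  let ?F = "E `` {x} - snd ` M" and ?F' = "delete_right b E `` {x} - snd ` M'"
  let ?v = "arg_min_on \<sigma> ?F" and ?v' = "arg_min_on \<sigma> ?F'"
  let ?N = "rank_step \<sigma> E M x" and ?N' = "rank_step \<sigma> (delete_right b E) M' x"
  have sub: "?F' \<subseteq> ?F" using Cons.prems(1) by auto
  have diff: "?F - ?F' \<subseteq> insert b (snd ` M')" by auto
  have v: "?v \<in> ?F" if "?F \<noteq> {}" using that by (rule arg_min_on_nat_in)
  have N: "?N = (if ?F = {} then M else insert (x, ?v) M)"
    and N': "?N' = (if ?F' = {} then M' else insert (x, ?v') M')"
    by (simp_all add: rank_step_def Let_def)
  have "snd ` ?N \<subseteq> insert b (snd ` ?N') \<and>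
      (\<forall>a u'. (a, u') \<in> ?N' \<longrightarrow> (\<exists>u. (a, u) \<in> ?N \<and> \<sigma> u \<le> \<sigma> u'))"
  proof (cases "?F' = {}")
    case True
    then have "?N' = M'" using N' by simp
    moreover have "\<exists>u. (a, u) \<in> ?N \<and> \<sigma> u \<le> \<sigma> u'" if "(a, u') \<in> M'" for a u'
      using Cons.prems(2)[OF that] rank_step_mono[of M \<sigma> E x] by blast
    \<comment> \<open>Here \<open>x\<close> has no choice in the run without \<open>b\<close>; any
      vertex it takes in the run with \<open>b\<close> is thus \<open>b\<close> or already used in
      the other run.\<close>
    moreover have "snd ` ?N \<subseteq> insert b (snd ` M')"
    proof (cases "?F = {}")
      case True
      then show ?thesis using N Cons.prems(1) by simp
    next
      case False
      then have "?v \<in> insert b (snd ` M')" using v[OF False] diff \<open>?F' = {}\<close> by blast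
      moreover have "?N = insert (x, ?v) M" using False N by simp
      ultimately show ?thesis using Cons.prems(1) by simp
    qed
    ultimately show ?thesis by simp
  next
    case False
    then have ne: "?F \<noteq> {}" using sub by blast
    have v': "?v' \<in> ?F'" using False by (rule arg_min_on_nat_in)
    then have le: "\<sigma> ?v \<le> \<sigma> ?v'" using sub by (intro arg_min_on_nat_le) blast
    have eqs: "?N = insert (x, ?v) M" "?N' = insert (x, ?v') M'" using N N' ne False by simp_all
    \<comment> \<open>If \<open>?v\<close> is also free in the run without \<open>b\<close>,
      minimality on both sides and injectivity force \<open>?v = ?v'\<close>. Otherwise it is
      \<open>b\<close> or was used there before.\<close>
    have "?v \<in> insert b (insert ?v' (snd ` M'))"
    proof (cases "?v \<in> ?F'")
      case True
      then have "\<sigma> ?v' \<le> \<sigma> ?v" by (rule arg_min_on_nat_le)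
      then have "?v = ?v'" using le assms(1) by (simp add: inj_eq)
      then show ?thesis by blast
    next
      case False
      then show ?thesis using v[OF ne] diff by blast
    qed
    then have "snd ` ?N \<subseteq> insert b (snd ` ?N')" unfolding eqs using Cons.prems(1) by auto
    moreover have "\<exists>u. (a, u) \<in> ?N \<and> \<sigma> u \<le> \<sigma> u'" if "(a, u') \<in> ?N'" for a u'
      using that le Cons.prems(2)[of a u'] unfolding eqs by auto
    ultimately show ?thesis by blast
  qed
  then show ?case using Cons.IH[of ?N ?N'] Cons.prems(3) by simp
qed simp

lemma online_ranking_dominates:
  assumes "inj \<sigma>" "(a, u') \<in> online_matching (ranking \<sigma>) (delete_right b E) as"
  obtains u where "(a, u) \<in> online_matching (ranking \<sigma>) E as" "\<sigma> u \<le> \<sigma> u'"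
  using foldl_rank_step_dominates[OF assms(1), of "{}" b "{}" a u' E as] assms(2)
  unfolding online_matching_ranking by auto

text \<open>On the arrival of \<open>a\<close> the neighbour \<open>b\<close> is free, so
  \<open>a\<close> takes a vertex of rank at most that of \<open>b\<close>. It cannot be
  \<open>b\<close>, which stays unmatched to the end.\<close>

lemma online_ranking_unmatched:
  assumes "inj \<sigma>" "a \<in> set as" "(a, b) \<in> E" "b \<notin> snd ` online_matching (ranking \<sigma>) E as"
  obtains u where "(a, u) \<in> online_matching (ranking \<sigma>) E as" "\<sigma> u < \<sigma> b"
proof -
  obtain xs ys where as: "as = xs @ a # ys" using assms(2) by (meson split_list)
  let ?M = "foldl (rank_step \<sigma> E) {} xs"
  let ?F = "E `` {a} - snd ` ?M"
  let ?v = "arg_min_on \<sigma> ?F"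
  have sub: "rank_step \<sigma> E ?M a \<subseteq> online_matching (ranking \<sigma>) E as"
    unfolding online_matching_ranking as using foldl_rank_step_mono by simp
  then have "b \<notin> snd ` ?M" using rank_step_mono[of ?M \<sigma> E a] assms(4) by blast
  then have b: "b \<in> ?F" using assms(3) by blast
  then have "(a, ?v) \<in> rank_step \<sigma> E ?M a" by (auto simp: rank_step_def Let_def)
  then have mem: "(a, ?v) \<in> online_matching (ranking \<sigma>) E as" using sub by blast
  then have "?v \<noteq> b" using assms(4) by force
  moreover have "\<sigma> ?v \<le> \<sigma> b" using b by (rule arg_min_on_nat_le)
  ultimately have "\<sigma> ?v < \<sigma> b" using assms(1) by (metis inj_eq le_neq_implies_less)
  with mem show ?thesis by (rule that)
qed


section \<open>The expected gain of an edge\<close>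

lemma is_category_perm_category_perm: "is_category_perm m c (category_perm m c)"
  unfolding category_perm_def using is_category_perm_ex1 by (rule theI')

lemma inj_category_perm: "inj (category_perm m c)"
  using is_category_perm_category_perm permutes_inj unfolding is_category_perm_def by blast

lemma category_perm_less_iff:
  "x \<in> {1..m} \<Longrightarrow> y \<in> {1..m} \<Longrightarrow>
    category_perm m c x < category_perm m c y \<longleftrightarrow> c x < c y \<or> c x = c y \<and> x < y"
  using is_category_perm_category_perm[of m c] unfolding is_category_perm_def by blast

text \<open>The rank order refines the category order. This carries comparisons of ranks in runs
  over to comparisons of shares.\<close>

lemma category_perm_le_imp:
  "x \<in> {1..m} \<Longrightarrow> y \<in> {1..m} \<Longrightarrow> category_perm m c x \<le> category_perm m c y \<Longrightarrow> c x \<le> c y"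
  using category_perm_less_iff[of y m x c] by force

text \<open>For \<open>K > 0\<close> and \<open>t \<le> K + 1\<close> this is
  \<open>(K / (K + 1)) ^ (K + 1 - t)\<close>, written as a geometric sequence in \<open>t\<close>
  with ratio \<open>(K + 1) / K\<close> so that no truncated subtraction occurs.\<close>

definition share :: "nat \<Rightarrow> nat \<Rightarrow> real" where
  "share K t = ((K + 1) / K) ^ t * (K / (K + 1)) ^ (K + 1)"

lemma share_nonneg: "share K t \<ge> 0"
  by (simp add: share_def)

lemma share_mono:
  assumes "K > 0" "s \<le> t"
  shows "share K s \<le> share K t"
  unfolding share_def using assms by (intro mult_right_mono power_increasing) (auto simp: field_simps)

lemma share_top:
  assumes "K > 0"
  shows "share K (K + 1) = 1"
proof -
  have "share K (K + 1) = ((real (K + 1) / K) * (K / real (K + 1))) ^ (K + 1)"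
    unfolding share_def by (simp only: power_mult_distrib of_nat_add of_nat_1)
  also have "(real (K + 1) / K) * (K / real (K + 1)) = 1" using assms by simp
  finally show ?thesis by simp
qed

lemma share_le_1: "K > 0 \<Longrightarrow> t \<le> K + 1 \<Longrightarrow> share K t \<le> 1"
  using share_mono[of K t "K + 1"] share_top[of K] by simp

lemma share_1:
  assumes "K > 0"
  shows "share K 1 = (K / (K + 1)) ^ K"
proof -
  have "share K 1 = (real (K + 1) / K * (K / real (K + 1))) * (K / real (K + 1)) ^ K"
    by (simp add: share_def add.commute)
  also have "real (K + 1) / K * (K / real (K + 1)) = 1" using assms by simp
  finally show ?thesis by (simp add: add.commute)
qed

lemma share_Suc:
  assumes "K > 0"
  shows "K * share K (Suc t) = real (K + 1) * share K t"
proof -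
  have "K * share K (Suc t) = K * (real (K + 1) / K) * share K t" by (simp add: share_def)
  also have "K * (real (K + 1) / K) = K + 1" using assms by simp
  finally show ?thesis .
qed

text \<open>By \<open>share_Suc\<close>, \<open>share K t\<close> is \<open>K\<close> times the
  increment from \<open>share K t\<close> to \<open>share K (Suc t)\<close>, so the sum
  telescopes.\<close>

lemma sum_share:
  assumes "K > 0" "y \<ge> 1"
  shows "(\<Sum>t = 1..<y. share K t) = K * (share K y - share K 1)"
  using assms(2)
proof (induction y rule: dec_induct)
  case (step y)
  then show ?case using share_Suc[OF assms(1), of y] by (simp add: algebra_simps)
qed simp

text \<open>The edges \<open>e'\<close> need not equal \<open>e\<close>: each endpoint contributes
  what it earns from whichever edge of \<open>M\<close> covers it. For a matching \<open>M\<close>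
  each sum has at most one term, and the empty sum encodes an unmatched endpoint.\<close>

definition edge_gain :: "nat \<Rightarrow> (nat \<Rightarrow> nat) \<Rightarrow> (nat \<times> nat) set \<Rightarrow> nat \<times> nat \<Rightarrow> real" where
  "edge_gain K c M e =
     (\<Sum>e' | e' \<in> M \<and> fst e' = fst e. 1 - share K (c (snd e'))) +
     (\<Sum>e' | e' \<in> M \<and> snd e' = snd e. share K (c (snd e')))"

text \<open>Double counting: injectivity of \<open>f\<close> on \<open>S\<close> lets each
  \<open>x\<close> in \<open>M\<close> be counted for at most one \<open>s\<close>.\<close>

lemma sum_fibres_le:
  fixes w :: "'a \<Rightarrow> real"
  assumes "finite S" "finite M" "inj_on f S" "\<And>x. x \<in> M \<Longrightarrow> w x \<ge> 0"
  shows "(\<Sum>s\<in>S. \<Sum>x | x \<in> M \<and> f x = f s. w x) \<le> (\<Sum>x\<in>M. w x)"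
proof -
  have "(\<Sum>s\<in>S. \<Sum>x | x \<in> M \<and> f x = f s. w x) = (\<Sum>x\<in>M. \<Sum>s | s \<in> S \<and> f x = f s. w x)"
    using assms(1,2) by (rule sum.swap_restrict)
  also have "\<dots> \<le> (\<Sum>x\<in>M. w x)"
  proof (rule sum_mono)
    fix x assume x: "x \<in> M"
    have "card {s \<in> S. f x = f s} \<le> 1"
      using assms(1,3) by (auto simp: card_le_Suc0_iff_eq inj_on_def)
    then show "(\<Sum>s | s \<in> S \<and> f x = f s. w x) \<le> w x"
      using assms(4)[OF x] by (simp add: mult_left_le_one_le)
  qed
  finally show ?thesis .
qed

text \<open>Edges of \<open>Mstar\<close> have no common endpoints, so each edge of \<open>M\<close>
  pays each of its two shares at most once, and these add up to 1. The bound \<open>K + 1\<close> on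
  categories keeps the share of the \<open>A\<close>-vertex nonnegative.\<close>

lemma sum_edge_gain_le:
  assumes "K > 0" "finite M" "finite Mstar" "inj_on fst Mstar" "inj_on snd Mstar"
    and "\<And>e. e \<in> M \<Longrightarrow> c (snd e) \<le> K + 1"
  shows "(\<Sum>e\<in>Mstar. edge_gain K c M e) \<le> card M"
proof -
  have "(\<Sum>e\<in>Mstar. edge_gain K c M e) \<le>
      (\<Sum>e\<in>M. 1 - share K (c (snd e))) + (\<Sum>e\<in>M. share K (c (snd e)))"
    unfolding edge_gain_def sum.distrib using assms
    by (intro add_mono sum_fibres_le) (auto intro: share_nonneg share_le_1)
  then show ?thesis by (simp add: sum_subtractf)
qed

text \<open>The average over the category \<open>x\<close> of \<open>b\<close>, multiplied by
  \<open>K\<close>. The function \<open>f\<close> fixes the other categories; its value at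
  \<open>b\<close> is overwritten.\<close>

lemma average_edge_gain_ge:
  fixes K m b :: nat and f :: "nat \<Rightarrow> nat" and E :: "(nat \<times> nat) set" and as :: "nat list"
  defines "M x \<equiv> online_matching (ranking (category_perm m (f(b := x)))) E as"
  assumes K: "K > 0" and E: "E \<subseteq> {1..n} \<times> {1..m}" and "distinct as"
    and a: "a \<in> set as" and ab: "(a, b) \<in> E"
    and f: "\<And>u. u \<in> {1..m} \<Longrightarrow> u \<noteq> b \<Longrightarrow> f u \<in> {1..K}"
  shows "(\<Sum>x = 1..K. edge_gain K (f(b := x)) (M x) (a, b)) \<ge> K * (1 - share K 1)"
proof -
  let ?\<sigma> = "\<lambda>x. category_perm m (f(b := x))"
  \<comment> \<open>The category 0 for \<open>b\<close> is an arbitrary choice: the run without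
    \<open>b\<close> is the same for every \<open>x\<close>.\<close>
  define M0 where "M0 = online_matching (ranking (?\<sigma> 0)) (delete_right b E) as"
  have finE: "finite E" using E by (rule finite_subset) simp
  have b: "b \<in> {1..m}" using ab E by auto
  have M0: "online_matching (ranking (?\<sigma> x)) (delete_right b E) as = M0" for x
    unfolding M0_def
  proof (rule online_ranking_order_cong)
    show "snd ` delete_right b E \<subseteq> {1..m} - {b}" using E by auto
  qed (auto simp: category_perm_less_iff)
  have M0_match: "is_matching (delete_right b E) M0"
    unfolding M0_def by (rule is_matching_online_ranking) fact
  have match: "is_matching E (M x)" for x
    unfolding M_def by (rule is_matching_online_ranking) fact
  have fin: "finite (M x)" for x
    using match[of x] finE finite_subset unfolding is_matching_def by blast
  have range: "u \<in> {1..m}" if "(a', u) \<in> M x" for a' u x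
    using that match[of x] E unfolding is_matching_def by auto
  have cat: "(f(b := x)) (snd e) \<le> K + 1" if "e \<in> M x" "x \<in> {1..K}" for e x
    using that range[of "fst e" "snd e" x] f[of "snd e"] by auto
  have gain_a: "(\<Sum>e | e \<in> M x \<and> fst e = a. 1 - share K ((f(b := x)) (snd e))) \<ge> 1 - share K t"
    if x: "x \<in> {1..K}" and "(a, u) \<in> M x" "(f(b := x)) u \<le> t" for x u t
  proof -
    have "1 - share K t \<le> 1 - share K ((f(b := x)) (snd (a, u)))"
      using share_mono[OF K that(3)] by simp
    also have "\<dots> \<le> (\<Sum>e | e \<in> M x \<and> fst e = a. 1 - share K ((f(b := x)) (snd e)))"
      using that(2) fin cat[OF _ x] share_le_1[OF K] by (intro member_le_sum) (auto simp del: fun_upd_apply)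
    finally show ?thesis .
  qed
  have gain_a_nonneg: "(\<Sum>e | e \<in> M x \<and> fst e = a. 1 - share K ((f(b := x)) (snd e))) \<ge> 0"
    if "x \<in> {1..K}" for x
    using cat[OF _ that] share_le_1[OF K] by (intro sum_nonneg) (auto simp del: fun_upd_apply)
  have gain_b: "(\<Sum>e | e \<in> M x \<and> snd e = b. share K ((f(b := x)) (snd e))) \<ge> share K x"
    if b_matched: "b \<in> snd ` M x" for x
  proof -
    obtain e where e: "e \<in> M x" "snd e = b" using b_matched by blast
    then have "share K x = share K ((f(b := x)) (snd e))" by simp
    also have "\<dots> \<le> (\<Sum>e | e \<in> M x \<and> snd e = b. share K ((f(b := x)) (snd e)))"
      using e fin by (intro member_le_sum) (auto simp: share_nonneg)
    finally show ?thesis .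
  qed
  have gain_b_nonneg: "(\<Sum>e | e \<in> M x \<and> snd e = b. share K ((f(b := x)) (snd e))) \<ge> 0" for x
    by (intro sum_nonneg share_nonneg)
  \<comment> \<open>If \<open>b\<close> stays free, the run is \<open>M0\<close> itself, and
    \<open>a\<close> has a partner ranked before \<open>b\<close>. By contraposition
    \<open>b\<close> is matched as soon as \<open>x\<close> is below the category of the partner of
    \<open>a\<close> in \<open>M0\<close>.\<close>
  have unmatched: "\<exists>u. (a, u) \<in> M0 \<and> u \<in> {1..m} - {b} \<and> f u \<le> x"
    if nb: "b \<notin> snd ` M x" for x
  proof -
    have eq: "M x = M0"
      using online_ranking_delete_right[OF inj_category_perm nb[unfolded M_def]] M0[of x]
      by (simp add: M_def)
    obtain u where u: "(a, u) \<in> M x" "?\<sigma> x u < ?\<sigma> x b"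
      using online_ranking_unmatched[OF inj_category_perm a ab nb[unfolded M_def]]
      unfolding M_def by blast
    have "u \<noteq> b" using u(2) by auto
    moreover have "(f(b := x)) u \<le> (f(b := x)) b"
      by (rule category_perm_le_imp[OF range[OF u(1)] b less_imp_le[OF u(2)]])
    ultimately show ?thesis using u(1) range[OF u(1)] unfolding eq by auto
  qed
  obtain y where y: "y \<in> {1..K + 1}"
    and ya: "\<And>x. x \<in> {1..K} \<Longrightarrow>
      (\<Sum>e | e \<in> M x \<and> fst e = a. 1 - share K ((f(b := x)) (snd e))) \<ge> 1 - share K y"
    and yb: "\<And>x. x < y \<Longrightarrow> x \<in> {1..K} \<Longrightarrow> b \<in> snd ` M x"
  proof (cases "a \<in> fst ` M0")
    case False
    show ?thesis
    \<comment> \<open>With \<open>share K (K + 1) = 1\<close> the bound for \<open>a\<close> is just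
      nonnegativity. A free \<open>b\<close> would give \<open>a\<close> a partner in
      \<open>M0\<close>, so \<open>b\<close> is matched for every \<open>x\<close>.\<close>
    proof (rule that[of "K + 1"])
      show "1 - share K (K + 1) \<le> (\<Sum>e | e \<in> M x \<and> fst e = a. 1 - share K ((f(b := x)) (snd e)))"
        if "x \<in> {1..K}" for x
        using gain_a_nonneg[OF that] share_top[OF K] by simp
      show "b \<in> snd ` M x" for x using unmatched[of x] False by force
    qed simp
  next
    case True
    then obtain v where v: "(a, v) \<in> M0" by force
    have vb: "v \<in> {1..m}" "v \<noteq> b" using v M0_match E unfolding is_matching_def by auto
    have unique: "u = v" if "(a, u) \<in> M0" for u
      using that v M0_match unfolding is_matching_def inj_on_def by fastforce
    show ?thesis
    proof (rule that[of "f v"])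
      show "f v \<in> {1..K + 1}" using f[OF vb] by auto
      show "b \<in> snd ` M x" if "x < f v" for x
        using unmatched[of x] unique that by force
      show "1 - share K (f v) \<le> (\<Sum>e | e \<in> M x \<and> fst e = a. 1 - share K ((f(b := x)) (snd e)))"
        if x: "x \<in> {1..K}" for x
      proof -
        have "(a, v) \<in> online_matching (ranking (?\<sigma> x)) (delete_right b E) as" using v M0 by simp
        then obtain u where u: "(a, u) \<in> M x" "?\<sigma> x u \<le> ?\<sigma> x v"
          unfolding M_def by (rule online_ranking_dominates[OF inj_category_perm])
        have "(f(b := x)) u \<le> (f(b := x)) v"
          by (rule category_perm_le_imp[OF range[OF u(1)] vb(1) u(2)])
        then have "(f(b := x)) u \<le> f v" using vb by simp
        then show ?thesis by (rule gain_a[OF x u(1)])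
      qed
    qed
  qed
  have "K * (1 - share K 1) = K * (1 - share K y) + (\<Sum>x = 1..<y. share K x)"
    using y sum_share[OF K, of y] by (simp add: algebra_simps)
  also have "\<dots> = (\<Sum>x = 1..K. 1 - share K y) + (\<Sum>x = 1..K. if x < y then share K x else 0)"
  proof -
    \<comment> \<open>Uses \<open>y \<le> K + 1\<close>: all \<open>x\<close> with
      \<open>1 \<le> x < y\<close> are possible categories.\<close>
    have "{1..K} \<inter> {x. x < y} = {1..<y}" using y by auto
    then show ?thesis by (simp add: sum.If_cases)
  qed
  also have "\<dots> \<le> (\<Sum>x = 1..K. edge_gain K (f(b := x)) (M x) (a, b))"
    unfolding edge_gain_def sum.distrib[symmetric] fst_conv snd_conv
    by (intro sum_mono add_mono) (use ya yb gain_b gain_b_nonneg in auto)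
  finally show ?thesis .
qed

section \<open>Averaging over all categories\<close>

lemma expectation_edge_gain_ge:
  fixes K m :: nat
  assumes K: "K > 0" and E: "E \<subseteq> {1..n} \<times> {1..m}" and as: "distinct as"
    and a: "a \<in> set as" and ab: "(a, b) \<in> E"
  shows "measure_pmf.expectation (Pi_pmf {1..m} 0 (\<lambda>_. pmf_of_set {1..K}))
      (\<lambda>c. edge_gain K c (online_matching (ranking (category_perm m c)) E as) (a, b))
    \<ge> 1 - share K 1"
proof -
  let ?B = "{1..m} - {b}" and ?U = "pmf_of_set {1..K}"
  let ?g = "\<lambda>c. edge_gain K c (online_matching (ranking (category_perm m c)) E as) (a, b)"
  let ?Q = "Pi_pmf ?B 0 (\<lambda>_. ?U)"
  have b: "b \<in> {1..m}" using ab E by auto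
  have ne: "{1..K} \<noteq> {}" using K by auto
  have supp: "set_pmf ?Q = PiE_dflt ?B 0 (\<lambda>_. {1..K})"
    using ne by (simp add: set_Pi_pmf)
  then have finQ: "finite (set_pmf ?Q)" by (auto intro: finite_PiE_dflt)
  have "Pi_pmf {1..m} 0 (\<lambda>_. ?U) = Pi_pmf (insert b ?B) 0 (\<lambda>_. ?U)"
    using b by (simp add: insert_absorb)
  also have "\<dots> = bind_pmf ?U (\<lambda>x. bind_pmf ?Q (\<lambda>f. return_pmf (f(b := x))))"
    by (rule Pi_pmf_insert') auto
  \<comment> \<open>The category of \<open>b\<close> is moved to the last draw, so that
    \<open>average_edge_gain_ge\<close> applies to each fixed outcome \<open>f\<close> of the
    others.\<close>
  also have "\<dots> = bind_pmf ?Q (\<lambda>f. map_pmf (\<lambda>x. f(b := x)) ?U)"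
    by (subst bind_commute_pmf) (simp add: map_pmf_def)
  finally have "measure_pmf.expectation (Pi_pmf {1..m} 0 (\<lambda>_. ?U)) ?g =
      (\<Sum>f\<in>set_pmf ?Q. pmf ?Q f *\<^sub>R measure_pmf.expectation (map_pmf (\<lambda>x. f(b := x)) ?U) ?g)"
    using finQ ne by (simp add: pmf_expectation_bind[where A = "set_pmf ?Q"])
  also have "\<dots> \<ge> (\<Sum>f\<in>set_pmf ?Q. pmf ?Q f *\<^sub>R (1 - share K 1))"
  proof (intro sum_mono scaleR_left_mono)
    fix f assume "f \<in> set_pmf ?Q"
    then have f: "f u \<in> {1..K}" if "u \<in> {1..m}" "u \<noteq> b" for u
      using that unfolding supp PiE_dflt_def by auto
    have "measure_pmf.expectation (map_pmf (\<lambda>x. f(b := x)) ?U) ?g =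
        (\<Sum>x = 1..K. ?g (f(b := x))) / K"
      using ne by (simp add: integral_pmf_of_set)
    moreover have "(\<Sum>x = 1..K. ?g (f(b := x))) \<ge> K * (1 - share K 1)"
      by (rule average_edge_gain_ge[OF K E as a ab f])
    ultimately show "1 - share K 1 \<le> measure_pmf.expectation (map_pmf (\<lambda>x. f(b := x)) ?U) ?g"
      using K by (simp only: pos_le_divide_eq of_nat_0_less_iff mult.commute)
  qed simp
  also have "(\<Sum>f\<in>set_pmf ?Q. pmf ?Q f *\<^sub>R (1 - share K 1)) = 1 - share K 1"
    using finQ by (simp add: sum_distrib_right[symmetric] sum_pmf_eq_1)
  finally show ?thesis .
qed

text \<open>Linearity of expectation sums the edgewise bounds over \<open>M'\<close>; for each
  outcome \<open>sum_edge_gain_le\<close> bounds the total gain by the size of the output.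
  Integrability follows from the finite support.\<close>

lemma expectation_card_ranking_ge:
  fixes K m :: nat
  assumes K: "K > 0" and E: "E \<subseteq> {1..n} \<times> {1..m}" and as: "distinct as" "set as = {1..n}"
    and M': "is_matching E M'"
  shows "measure_pmf.expectation (Pi_pmf {1..m} 0 (\<lambda>_. pmf_of_set {1..K}))
      (\<lambda>c. real (card (online_matching (ranking (category_perm m c)) E as)))
    \<ge> (1 - share K 1) * card M'"
proof -
  let ?P = "Pi_pmf {1..m} 0 (\<lambda>_. pmf_of_set {1..K})"
  let ?M = "\<lambda>c. online_matching (ranking (category_perm m c)) E as"
  have finE: "finite E" using E by (rule finite_subset) simp
  have sub: "M' \<subseteq> E" using M' by (simp add: is_matching_def)
  have supp: "set_pmf ?P = PiE_dflt {1..m} 0 (\<lambda>_. {1..K})"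
    using K by (simp add: set_Pi_pmf)
  then have int: "integrable (measure_pmf ?P) g" for g :: "_ \<Rightarrow> real"
    by (intro integrable_measure_pmf_finite) (auto intro: finite_PiE_dflt)
  have "(1 - share K 1) * card M' = (\<Sum>e\<in>M'. 1 - share K 1)" by simp
  also have "\<dots> \<le> (\<Sum>e\<in>M'. measure_pmf.expectation ?P (\<lambda>c. edge_gain K c (?M c) e))"
  proof (rule sum_mono)
    fix e assume "e \<in> M'"
    then have e: "(fst e, snd e) \<in> E" using sub by auto
    then have "fst e \<in> set as" using E as(2) by auto
    from expectation_edge_gain_ge[OF K E as(1) this e]
    show "1 - share K 1 \<le> measure_pmf.expectation ?P (\<lambda>c. edge_gain K c (?M c) e)" by simp
  qed
  also have "\<dots> = measure_pmf.expectation ?P (\<lambda>c. \<Sum>e\<in>M'. edge_gain K c (?M c) e)"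
    using int by (subst Bochner_Integration.integral_sum) auto
  also have "\<dots> \<le> measure_pmf.expectation ?P (\<lambda>c. real (card (?M c)))"
  proof (rule integral_mono_AE[OF int int], rule AE_pmfI)
    fix c assume "c \<in> set_pmf ?P"
    then have c: "c u \<in> {1..K}" if "u \<in> {1..m}" for u
      using that unfolding supp PiE_dflt_def by auto
    have M: "?M c \<subseteq> E" using is_matching_online_ranking[OF as(1)] by (simp add: is_matching_def)
    show "(\<Sum>e\<in>M'. edge_gain K c (?M c) e) \<le> real (card (?M c))"
    proof (rule sum_edge_gain_le[OF K])
      show "c (snd e) \<le> K + 1" if "e \<in> ?M c" for e
      proof -
        have "snd e \<in> {1..m}" using that M E by auto
        from c[OF this] show ?thesis by simp
      qed
    qed (use M sub finE M' in \<open>auto intro: finite_subset simp: is_matching_def\<close>)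
  qed
  finally show ?thesis .
qed

theorem theorem17:
  fixes k :: nat
  assumes "k \<ge> 1"
  shows "(\<forall>m. coin_pmf (random_categories k m) =
              Pi_pmf {1..m} 0 (\<lambda>_. pmf_of_set {1..2 ^ k}))
    \<and> (\<forall>m. uses_random_bits (category_ranking k m) (k * m))
    \<and> legal_algorithm (category_ranking k)
    \<and> has_competitive_ratio (category_ranking k) (1 - (2 ^ k / (2 ^ k + 1)) ^ (2 ^ k))"
proof (intro conjI allI)
  show "legal_algorithm (category_ranking k)"
    by (auto simp: legal_algorithm_def coin_pmf_category_ranking legal_rule_ranking)
  \<comment> \<open>The expected loss per edge, \<open>share K 1\<close> at
    \<open>K = 2 ^ k\<close>, is the power in the competitive ratio.\<close>
  have share: "share (2 ^ k) 1 = (2 ^ k / (2 ^ k + 1)) ^ (2 ^ k)"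
    by (subst share_1) simp_all
  show "has_competitive_ratio (category_ranking k) (1 - (2 ^ k / (2 ^ k + 1)) ^ (2 ^ k))"
    unfolding has_competitive_ratio_def coin_pmf_category_ranking integral_map_pmf share[symmetric]
    using expectation_card_ranking_ge[of "2 ^ k"] by (auto simp: is_maximum_matching_def)
qed (fact coin_pmf_random_categories uses_random_bits_category_ranking)+

end
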